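(* For all integers $n \ge 1$ and $r,s\ge 0$, one has in $R_n$ the identity $F_{1^r}F_{1^s}=a_{r,s}F_{1^{r+s}}$, where $$a_{r,s}=\begin{cases}0 & \text{if } r \text{ and } s \text{ are both odd},\\[4pt] \displaystyle\binom{\lfloor \frac{r+s}{2}\rfloor}{\lfloor \frac{r}{2}\rfloor} & \text{otherwise.}\end{cases}$$
   Context: Let $R_n=\mathbb{Q}[\theta_1,\dots,\theta_n]$ be the polynomial ring in anticommuting variables over $\mathbb{Q}$ (the exterior algebra on $n$ generators): $\theta_i\theta_j=-\theta_j\theta_i$ for $i\ne j$ and $\theta_i^2=0$. For $A=\{a_1<\cdots<a_r\}\subseteq [n]=\{1,\dots,n\}$ put $\theta_A=\theta_{a_1}\cdots\theta_{a_r}$; these form a basis of $R_n$. For $r\ge 0$ define $F_{1^r}=F_{1^r}(\theta_1,\dots,\theta_n)=\sum_{A\subseteq[n],\,|A|=r}\theta_A$ (so $F_{1^0}=1$ and $F_{1^r}=0$ if $r>n$). *)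

theory Defs
  imports Complex_Main "HOL-Algebra.Module"
begin

text \<open>
  The exterior algebra \<open>R\<^sub>n\<close> over the rationals, in coordinates with respect to the basis of
  monomials: a function \<open>f\<close> supported on the subsets of \<open>{1..n}\<close> stands for
  \<open>\<Sum>A. f A \<theta>\<^sub>A\<close>.  For disjoint \<open>A\<close> and \<open>B\<close>, sorting the word \<open>\<theta>\<^sub>A \<theta>\<^sub>B\<close> takes one
  transposition for every pair \<open>b < a\<close> with \<open>a \<in> A\<close> and \<open>b \<in> B\<close>, which gives the sign in the
  product.  That this is the algebra generated by \<open>\<theta>\<^sub>1, \<dots>, \<theta>\<^sub>n\<close> subject to
  \<open>\<theta>\<^sub>i \<theta>\<^sub>j = - \<theta>\<^sub>j \<theta>\<^sub>i\<close> and \<open>\<theta>\<^sub>i \<theta>\<^sub>i = 0\<close>, with the ordered monomials as a basis, is the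
  content of the lemmas below.
\<close>

definition shuffle_sign :: "nat set \<Rightarrow> nat set \<Rightarrow> rat" where
  "shuffle_sign A B = (-1) ^ card {(a, b). a \<in> A \<and> b \<in> B \<and> b < a}"

definition exterior_algebra :: "nat \<Rightarrow> (rat, nat set \<Rightarrow> rat) module" where
  "exterior_algebra n =
    \<lparr>carrier = {f. \<forall>A. f A \<noteq> 0 \<longrightarrow> A \<subseteq> {1..n}},
     mult = (\<lambda>f g C. \<Sum>A\<in>Pow C. shuffle_sign A (C - A) * f A * g (C - A)),
     one = (\<lambda>A. if A = {} then 1 else 0),
     zero = (\<lambda>A. 0),
     add = (\<lambda>f g A. f A + g A),
     smult = (\<lambda>c f A. c * f A)\<rparr>"

definition theta :: "nat \<Rightarrow> nat set \<Rightarrow> rat" where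
  "theta i = (\<lambda>A. if A = {i} then 1 else 0)"

definition theta_set :: "nat \<Rightarrow> nat set \<Rightarrow> nat set \<Rightarrow> rat" where
  "theta_set n A =
    foldr (\<lambda>i f. theta i \<otimes>\<^bsub>exterior_algebra n\<^esub> f) (sorted_list_of_set A) \<one>\<^bsub>exterior_algebra n\<^esub>"

definition F_ones :: "nat \<Rightarrow> nat \<Rightarrow> nat set \<Rightarrow> rat" where
  "F_ones n r = (\<Oplus>\<^bsub>exterior_algebra n\<^esub>A\<in>{A. A \<subseteq> {1..n} \<and> card A = r}. theta_set n A)"

definition a_coeff :: "nat \<Rightarrow> nat \<Rightarrow> nat" where
  "a_coeff r s = (if odd r \<and> odd s then 0 else ((r + s) div 2) choose (r div 2))"


subsection \<open>The exterior algebra is an associative unital algebra\<close>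

lemmas exterior_algebra_simps =
  exterior_algebra_def partial_object.simps monoid.simps ring.simps module.simps

lemma finite_inversions:
  "finite A \<Longrightarrow> finite B \<Longrightarrow> finite {(a, b). a \<in> A \<and> b \<in> B \<and> b < (a::nat)}"
  by (rule finite_subset[of _ "A \<times> B"]) auto

lemma shuffle_sign_empty [simp]: "shuffle_sign {} B = 1" "shuffle_sign A {} = 1"
  by (simp_all add: shuffle_sign_def)

lemma shuffle_sign_Un_left:
  assumes "finite A" "finite A'" "finite B" "A \<inter> A' = {}"
  shows "shuffle_sign (A \<union> A') B = shuffle_sign A B * shuffle_sign A' B"
proof -
  have "{(a, b). a \<in> A \<union> A' \<and> b \<in> B \<and> b < a}
      = {(a, b). a \<in> A \<and> b \<in> B \<and> b < a} \<union> {(a, b). a \<in> A' \<and> b \<in> B \<and> b < a}"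
    by auto
  moreover have "{(a, b). a \<in> A \<and> b \<in> B \<and> b < a} \<inter> {(a, b). a \<in> A' \<and> b \<in> B \<and> b < a} = {}"
    using assms(4) by auto
  ultimately show ?thesis
    using assms by (simp add: shuffle_sign_def card_Un_disjoint finite_inversions power_add)
qed

lemma shuffle_sign_Un_right:
  assumes "finite A" "finite B" "finite B'" "B \<inter> B' = {}"
  shows "shuffle_sign A (B \<union> B') = shuffle_sign A B * shuffle_sign A B'"
proof -
  have "{(a, b). a \<in> A \<and> b \<in> B \<union> B' \<and> b < a}
      = {(a, b). a \<in> A \<and> b \<in> B \<and> b < a} \<union> {(a, b). a \<in> A \<and> b \<in> B' \<and> b < a}"
    by auto
  moreover have "{(a, b). a \<in> A \<and> b \<in> B \<and> b < a} \<inter> {(a, b). a \<in> A \<and> b \<in> B' \<and> b < a} = {}"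
    using assms(4) by auto
  ultimately show ?thesis
    using assms by (simp add: shuffle_sign_def card_Un_disjoint finite_inversions power_add)
qed

lemma exterior_mult_closed:
  assumes "f \<in> carrier (exterior_algebra n)" "g \<in> carrier (exterior_algebra n)"
  shows "f \<otimes>\<^bsub>exterior_algebra n\<^esub> g \<in> carrier (exterior_algebra n)"
  unfolding exterior_algebra_simps mem_Collect_eq
proof (intro allI impI)
  fix C assume "(\<Sum>A\<in>Pow C. shuffle_sign A (C - A) * f A * g (C - A)) \<noteq> 0"
  then obtain A where A: "A \<in> Pow C" "shuffle_sign A (C - A) * f A * g (C - A) \<noteq> 0"
    by (meson sum.not_neutral_contains_not_neutral)
  hence "A \<subseteq> {1..n}" "C - A \<subseteq> {1..n}"
    using assms unfolding exterior_algebra_simps by auto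
  thus "C \<subseteq> {1..n}" by blast
qed

lemma exterior_mult_assoc:
  "(f \<otimes>\<^bsub>exterior_algebra n\<^esub> g) \<otimes>\<^bsub>exterior_algebra n\<^esub> h
    = f \<otimes>\<^bsub>exterior_algebra n\<^esub> (g \<otimes>\<^bsub>exterior_algebra n\<^esub> h)"
  (is "?L = ?R")
proof
  fix D show "?L D = ?R D"
  proof (cases "finite D")
    case False
    thus ?thesis by (simp add: exterior_algebra_simps)
  next
    case True
    have sgn: "shuffle_sign (B \<union> E) (D - (B \<union> E)) * shuffle_sign B E
        = shuffle_sign B (D - B) * shuffle_sign E (D - B - E)"
      if "B \<subseteq> D" "E \<subseteq> D - B" for B E
    proof -
      have fin: "finite B" "finite E" "finite (D - B - E)" "finite (D - (B \<union> E))"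
        using that True by (auto intro: finite_subset)
      have eq: "D - (B \<union> E) = D - B - E" by auto
      have "shuffle_sign (B \<union> E) (D - (B \<union> E))
          = shuffle_sign B (D - B - E) * shuffle_sign E (D - B - E)"
        unfolding eq using fin that by (intro shuffle_sign_Un_left) auto
      moreover have "shuffle_sign B (E \<union> (D - B - E))
          = shuffle_sign B E * shuffle_sign B (D - B - E)"
        using fin that by (intro shuffle_sign_Un_right) auto
      moreover have "E \<union> (D - B - E) = D - B" using that by auto
      ultimately show ?thesis by simp
    qed
    have "?L D = (\<Sum>A\<in>Pow D. \<Sum>B\<in>Pow A.
        shuffle_sign A (D - A) * shuffle_sign B (A - B) * f B * g (A - B) * h (D - A))"
      by (simp add: exterior_algebra_simps sum_distrib_left sum_distrib_right mult_ac)
    also have "\<dots> = (\<Sum>(A, B)\<in>Sigma (Pow D) Pow.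
        shuffle_sign A (D - A) * shuffle_sign B (A - B) * f B * g (A - B) * h (D - A))"
      using True by (intro sum.Sigma) (auto intro: finite_subset)
    also have "\<dots> = (\<Sum>(B, E)\<in>Sigma (Pow D) (\<lambda>B. Pow (D - B)).
        shuffle_sign B (D - B) * shuffle_sign E (D - B - E) * f B * g E * h (D - B - E))"
    proof (rule sum.reindex_bij_witness[where i = "\<lambda>(B, E). (B \<union> E, B)" and j = "\<lambda>(A, B). (B, A - B)"],
        goal_cases)
      case (5 p)
      obtain A B where p: "p = (A, B)" by fastforce
      have AB: "B \<subseteq> D" "A - B \<subseteq> D - B" "B \<union> (A - B) = A" "D - B - (A - B) = D - A"
        using 5 p by auto
      show ?case using sgn[OF AB(1,2)] unfolding AB p by (simp add: AB)
    qed auto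
    also have "\<dots> = (\<Sum>B\<in>Pow D. \<Sum>E\<in>Pow (D - B).
        shuffle_sign B (D - B) * shuffle_sign E (D - B - E) * f B * g E * h (D - B - E))"
      using True by (intro sum.Sigma[symmetric]) auto
    also have "\<dots> = ?R D"
      by (simp add: exterior_algebra_simps sum_distrib_left mult_ac)
    finally show ?thesis .
  qed
qed

lemma exterior_one_mult:
  assumes "f \<in> carrier (exterior_algebra n)"
  shows "\<one>\<^bsub>exterior_algebra n\<^esub> \<otimes>\<^bsub>exterior_algebra n\<^esub> f = f"
    and "f \<otimes>\<^bsub>exterior_algebra n\<^esub> \<one>\<^bsub>exterior_algebra n\<^esub> = f"
proof -
  have inf: "f C = 0" if "infinite C" for C
  proof (rule ccontr)
    assume "f C \<noteq> 0"
    hence "C \<subseteq> {1..n}" using assms by (simp add: exterior_algebra_simps)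
    thus False using that finite_subset by blast
  qed
  show "\<one>\<^bsub>exterior_algebra n\<^esub> \<otimes>\<^bsub>exterior_algebra n\<^esub> f = f"
  proof
    fix C
    have "(\<one>\<^bsub>exterior_algebra n\<^esub> \<otimes>\<^bsub>exterior_algebra n\<^esub> f) C
        = (\<Sum>A\<in>Pow C. if A = {} then f C else 0)"
      by (auto simp: exterior_algebra_simps intro!: sum.cong)
    also have "\<dots> = f C" by (cases "finite C") (auto simp: inf)
    finally show "(\<one>\<^bsub>exterior_algebra n\<^esub> \<otimes>\<^bsub>exterior_algebra n\<^esub> f) C = f C" .
  qed
  show "f \<otimes>\<^bsub>exterior_algebra n\<^esub> \<one>\<^bsub>exterior_algebra n\<^esub> = f"
  proof
    fix C
    have "(f \<otimes>\<^bsub>exterior_algebra n\<^esub> \<one>\<^bsub>exterior_algebra n\<^esub>) C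
        = (\<Sum>A\<in>Pow C. if A = C then f C else 0)"
    proof -
      have "C - A = {} \<longleftrightarrow> A = C" if "A \<in> Pow C" for A using that by auto
      thus ?thesis by (auto simp: exterior_algebra_simps intro!: sum.cong)
    qed
    also have "\<dots> = f C" by (cases "finite C") (auto simp: inf)
    finally show "(f \<otimes>\<^bsub>exterior_algebra n\<^esub> \<one>\<^bsub>exterior_algebra n\<^esub>) C = f C" .
  qed
qed

lemma ring_exterior_algebra: "ring (exterior_algebra n)"
proof (rule ringI)
  show "abelian_group (exterior_algebra n)"
  proof (rule abelian_groupI)
    fix f assume f: "f \<in> carrier (exterior_algebra n)"
    show "\<exists>g\<in>carrier (exterior_algebra n). g \<oplus>\<^bsub>exterior_algebra n\<^esub> f = \<zero>\<^bsub>exterior_algebra n\<^esub>"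
      using f by (intro bexI[of _ "\<lambda>A. - f A"]) (auto simp: exterior_algebra_simps)
  next
    fix f g
    assume "f \<in> carrier (exterior_algebra n)" "g \<in> carrier (exterior_algebra n)"
    hence "f A = 0 \<and> g A = 0" if "\<not> A \<subseteq> {1..n}" for A
      using that unfolding exterior_algebra_simps by blast
    hence "A \<subseteq> {1..n}" if "f A + g A \<noteq> 0" for A
      using that by force
    thus "f \<oplus>\<^bsub>exterior_algebra n\<^esub> g \<in> carrier (exterior_algebra n)"
      unfolding exterior_algebra_simps by blast
  qed (auto simp: exterior_algebra_simps algebra_simps)
  show "Group.monoid (exterior_algebra n)"
  proof (rule monoidI)
    show "\<one>\<^bsub>exterior_algebra n\<^esub> \<in> carrier (exterior_algebra n)"
      by (simp add: exterior_algebra_simps)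
  qed (simp_all add: exterior_mult_closed exterior_mult_assoc exterior_one_mult)
qed (simp_all add: exterior_algebra_simps algebra_simps sum.distrib)

lemma exterior_smult_closed:
  "f \<in> carrier (exterior_algebra n) \<Longrightarrow> c \<odot>\<^bsub>exterior_algebra n\<^esub> f \<in> carrier (exterior_algebra n)"
  by (simp add: exterior_algebra_simps)

lemma exterior_smult:
  "1 \<odot>\<^bsub>exterior_algebra n\<^esub> f = f"
  "(c * d) \<odot>\<^bsub>exterior_algebra n\<^esub> f = c \<odot>\<^bsub>exterior_algebra n\<^esub> (d \<odot>\<^bsub>exterior_algebra n\<^esub> f)"
  "(c + d) \<odot>\<^bsub>exterior_algebra n\<^esub> f
    = c \<odot>\<^bsub>exterior_algebra n\<^esub> f \<oplus>\<^bsub>exterior_algebra n\<^esub> d \<odot>\<^bsub>exterior_algebra n\<^esub> f"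
  "c \<odot>\<^bsub>exterior_algebra n\<^esub> (f \<oplus>\<^bsub>exterior_algebra n\<^esub> g)
    = c \<odot>\<^bsub>exterior_algebra n\<^esub> f \<oplus>\<^bsub>exterior_algebra n\<^esub> c \<odot>\<^bsub>exterior_algebra n\<^esub> g"
  "(c \<odot>\<^bsub>exterior_algebra n\<^esub> f) \<otimes>\<^bsub>exterior_algebra n\<^esub> g
    = c \<odot>\<^bsub>exterior_algebra n\<^esub> (f \<otimes>\<^bsub>exterior_algebra n\<^esub> g)"
  "f \<otimes>\<^bsub>exterior_algebra n\<^esub> (c \<odot>\<^bsub>exterior_algebra n\<^esub> g)
    = c \<odot>\<^bsub>exterior_algebra n\<^esub> (f \<otimes>\<^bsub>exterior_algebra n\<^esub> g)"
  by (simp_all add: exterior_algebra_simps algebra_simps sum_distrib_left)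


subsection \<open>Generators, relations and the monomial basis\<close>

lemma theta_closed: "i \<in> {1..n} \<Longrightarrow> theta i \<in> carrier (exterior_algebra n)"
  by (simp add: exterior_algebra_simps theta_def)

lemma theta_mult:
  "(theta i \<otimes>\<^bsub>exterior_algebra n\<^esub> f) C
    = (if finite C \<and> i \<in> C then shuffle_sign {i} (C - {i}) * f (C - {i}) else 0)"
proof -
  have "(theta i \<otimes>\<^bsub>exterior_algebra n\<^esub> f) C
      = (\<Sum>A\<in>Pow C. if A = {i} then shuffle_sign {i} (C - {i}) * f (C - {i}) else 0)"
    by (auto simp: exterior_algebra_simps theta_def intro!: sum.cong)
  thus ?thesis by (cases "finite C") auto
qed

lemma theta_square: "theta i \<otimes>\<^bsub>exterior_algebra n\<^esub> theta i = \<zero>\<^bsub>exterior_algebra n\<^esub>"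
proof
  fix C show "(theta i \<otimes>\<^bsub>exterior_algebra n\<^esub> theta i) C = \<zero>\<^bsub>exterior_algebra n\<^esub> C"
    unfolding theta_mult by (auto simp: theta_def exterior_algebra_simps)
qed

lemma theta_anticommute:
  assumes "i \<in> {1..n}" "j \<in> {1..n}" "i \<noteq> j"
  shows "theta i \<otimes>\<^bsub>exterior_algebra n\<^esub> theta j
    = \<ominus>\<^bsub>exterior_algebra n\<^esub> (theta j \<otimes>\<^bsub>exterior_algebra n\<^esub> theta i)"
proof -
  interpret ring "exterior_algebra n" by (rule ring_exterior_algebra)
  have card: "shuffle_sign {a} {b} = (if b < a then -1 else 1)" for a b
  proof -
    have "{(x, y). x \<in> {a} \<and> y \<in> {b} \<and> y < x} = (if b < a then {(a, b)} else {})" by auto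
    thus ?thesis by (simp add: shuffle_sign_def)
  qed
  have *: "C - {a} = {b} \<and> a \<in> C \<longleftrightarrow> C = {a, b}" if "a \<noteq> b" for a b :: nat and C
    using that by auto
  have val: "(theta a \<otimes>\<^bsub>exterior_algebra n\<^esub> theta b) C
      = (if C = {a, b} then shuffle_sign {a} {b} else 0)" if "a \<noteq> b" for a b C
    using *[OF that, of C] unfolding theta_mult by (auto simp: theta_def)
  have "theta i \<otimes>\<^bsub>exterior_algebra n\<^esub> theta j \<oplus>\<^bsub>exterior_algebra n\<^esub> theta j \<otimes>\<^bsub>exterior_algebra n\<^esub> theta i
      = \<zero>\<^bsub>exterior_algebra n\<^esub>"
  proof
    fix C
    have "(theta i \<otimes>\<^bsub>exterior_algebra n\<^esub> theta j \<oplus>\<^bsub>exterior_algebra n\<^esub> theta j \<otimes>\<^bsub>exterior_algebra n\<^esub> theta i) C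
      = (theta i \<otimes>\<^bsub>exterior_algebra n\<^esub> theta j) C + (theta j \<otimes>\<^bsub>exterior_algebra n\<^esub> theta i) C"
      by (simp add: exterior_algebra_def)
    also have "\<dots> = 0"
      unfolding val[OF assms(3)] val[OF assms(3)[symmetric]]
      using assms(3) by (auto simp: card insert_commute)
    finally show "(theta i \<otimes>\<^bsub>exterior_algebra n\<^esub> theta j \<oplus>\<^bsub>exterior_algebra n\<^esub> theta j \<otimes>\<^bsub>exterior_algebra n\<^esub> theta i) C
      = \<zero>\<^bsub>exterior_algebra n\<^esub> C"
      by (simp add: exterior_algebra_def)
  qed
  thus ?thesis
    using minus_equality m_closed theta_closed assms(1,2) by metis
qed

lemma theta_set_eq:
  assumes "finite A"
  shows "theta_set n A = (\<lambda>B. if B = A then 1 else 0)"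
proof -
  have "foldr (\<lambda>i f. theta i \<otimes>\<^bsub>exterior_algebra n\<^esub> f) xs \<one>\<^bsub>exterior_algebra n\<^esub>
      = (\<lambda>B. if B = set xs then 1 else 0)" if "sorted_wrt (<) xs" for xs
    using that
  proof (induction xs)
    case Nil
    show ?case by (auto simp: exterior_algebra_simps)
  next
    case (Cons i xs)
    have sgn: "shuffle_sign {i} (set xs) = 1"
    proof -
      have "{(a, b). a \<in> {i} \<and> b \<in> set xs \<and> b < a} = {}" using Cons.prems by auto
      thus ?thesis unfolding shuffle_sign_def by (simp only: card.empty power_0)
    qed
    have notin: "i \<notin> set xs" using Cons.prems by auto
    have iff: "i \<in> C \<and> C - {i} = set xs \<longleftrightarrow> C = insert i (set xs)" for C
      using notin by auto
    have "(foldr (\<lambda>i f. theta i \<otimes>\<^bsub>exterior_algebra n\<^esub> f) (i # xs) \<one>\<^bsub>exterior_algebra n\<^esub>) C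
        = (if C = set (i # xs) then 1 else 0)" for C
    proof -
      have IH: "foldr (\<lambda>i f. theta i \<otimes>\<^bsub>exterior_algebra n\<^esub> f) xs \<one>\<^bsub>exterior_algebra n\<^esub>
          = (\<lambda>B. if B = set xs then 1 else 0)" using Cons by simp
      show ?thesis
        using iff[of C] sgn unfolding foldr.simps o_def IH theta_mult by auto
    qed
    thus ?case by blast
  qed
  from this[of "sorted_list_of_set A"] show ?thesis
    using assms by (simp add: theta_set_def)
qed

lemma theta_set_closed: "A \<subseteq> {1..n} \<Longrightarrow> theta_set n A \<in> carrier (exterior_algebra n)"
  using finite_subset[of A "{1..n}"] by (simp add: theta_set_eq exterior_algebra_simps)

lemma exterior_finsum_apply:
  assumes "finite I" "\<And>i. i \<in> I \<Longrightarrow> f i \<in> carrier (exterior_algebra n)"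
  shows "(\<Oplus>\<^bsub>exterior_algebra n\<^esub>i\<in>I. f i) B = (\<Sum>i\<in>I. f i B)"
  using assms
proof (induction I rule: finite_induct)
  interpret ring "exterior_algebra n" by (rule ring_exterior_algebra)
  case empty
  have "\<zero>\<^bsub>exterior_algebra n\<^esub> B = 0" by (simp add: exterior_algebra_def)
  thus ?case by simp
next
  interpret ring "exterior_algebra n" by (rule ring_exterior_algebra)
  case (insert i I)
  hence "(\<Oplus>\<^bsub>exterior_algebra n\<^esub>i\<in>insert i I. f i)
      = f i \<oplus>\<^bsub>exterior_algebra n\<^esub> (\<Oplus>\<^bsub>exterior_algebra n\<^esub>i\<in>I. f i)"
    by (intro finsum_insert) auto
  moreover have "(g \<oplus>\<^bsub>exterior_algebra n\<^esub> h) B = g B + h B" for g h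
    by (simp add: exterior_algebra_def)
  ultimately show ?case using insert by simp
qed

lemma theta_set_combination:
  "(\<Oplus>\<^bsub>exterior_algebra n\<^esub>A\<in>Pow {1..n}. c A \<odot>\<^bsub>exterior_algebra n\<^esub> theta_set n A) B
    = (if B \<subseteq> {1..n} then c B else 0)"
proof -
  have "(\<Oplus>\<^bsub>exterior_algebra n\<^esub>A\<in>Pow {1..n}. c A \<odot>\<^bsub>exterior_algebra n\<^esub> theta_set n A) B
      = (\<Sum>A\<in>Pow {1..n}. (c A \<odot>\<^bsub>exterior_algebra n\<^esub> theta_set n A) B)"
    by (intro exterior_finsum_apply) (auto intro!: exterior_smult_closed theta_set_closed simp del: One_nat_def)
  also have "\<dots> = (\<Sum>A\<in>Pow {1..n}. if B = A then c B else 0)"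
  proof (rule sum.cong[OF refl])
    fix A assume "A \<in> Pow {1..n}"
    hence "finite A" using finite_subset by blast
    thus "(c A \<odot>\<^bsub>exterior_algebra n\<^esub> theta_set n A) B = (if B = A then c B else 0)"
      by (simp add: theta_set_eq exterior_algebra_def)
  qed
  also have "\<dots> = (if B \<subseteq> {1..n} then c B else 0)" by simp
  finally show ?thesis .
qed

lemma theta_set_basis:
  assumes "f \<in> carrier (exterior_algebra n)"
  shows "\<exists>!c. c \<in> Pow {1..n} \<rightarrow>\<^sub>E (UNIV :: rat set) \<and>
    f = (\<Oplus>\<^bsub>exterior_algebra n\<^esub>A\<in>Pow {1..n}. c A \<odot>\<^bsub>exterior_algebra n\<^esub> theta_set n A)"
proof (rule ex1I[of _ "restrict f (Pow {1..n})"], intro conjI)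
  have "f B = 0" if "\<not> B \<subseteq> {1..n}" for B
    using assms that unfolding exterior_algebra_simps by blast
  thus "f = (\<Oplus>\<^bsub>exterior_algebra n\<^esub>A\<in>Pow {1..n}.
      restrict f (Pow {1..n}) A \<odot>\<^bsub>exterior_algebra n\<^esub> theta_set n A)"
    by (intro ext, unfold theta_set_combination) simp
next
  fix c assume c: "c \<in> Pow {1..n} \<rightarrow>\<^sub>E (UNIV :: rat set) \<and>
    f = (\<Oplus>\<^bsub>exterior_algebra n\<^esub>A\<in>Pow {1..n}. c A \<odot>\<^bsub>exterior_algebra n\<^esub> theta_set n A)"
  have "c B = restrict f (Pow {1..n}) B" for B
  proof (cases "B \<subseteq> {1..n}")
    case True
    thus ?thesis using conjunct2[OF c] theta_set_combination[of n c B] by simp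
  next
    case False
    thus ?thesis using PiE_arb[OF conjunct1[OF c], of B] by simp
  qed
  thus "c = restrict f (Pow {1..n})" by (rule ext)
qed simp

end

theory Submission
  imports Defs
begin

text \<open>
  The coefficient of \<open>\<theta>\<^sub>C\<close> in the product is the sum of the shuffle signs over all ways to split \<open>C\<close>
  into \<open>r\<close> and \<open>s\<close> elements, which is the Gaussian binomial coefficient at \<open>q = -1\<close>.  Removing
  the largest element of \<open>C\<close> gives the \<open>q\<close>-Pascal recursion, which \<open>a_coeff\<close> satisfies as well.
\<close>

lemma a_coeff_0 [simp]: "a_coeff 0 s = 1" "a_coeff r 0 = 1"
  by (simp_all add: a_coeff_def)

text \<open>The \<open>q\<close>-Pascal rule at \<open>q = -1\<close>. If \<open>r\<close> and
  \<open>s\<close> are both even, the two terms on the right cancel; for mixed parity one of them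
  vanishes and the other is the left side; if both are odd, it is Pascal's rule.\<close>

lemma a_coeff_Suc_Suc:
  "rat_of_nat (a_coeff (Suc r) (Suc s))
    = rat_of_nat (a_coeff (Suc r) s) + (-1) ^ Suc s * rat_of_nat (a_coeff r (Suc s))"
proof (cases "even r"; cases "even s")
  assume "even r" "even s"
  then obtain i j where "r = 2 * i" "s = 2 * j" by (elim evenE)
  thus ?thesis by (simp add: a_coeff_def)
next
  assume "even r" "odd s"
  then obtain i j where "r = 2 * i" "s = Suc (2 * j)" by (auto elim!: evenE oddE)
  thus ?thesis by (simp add: a_coeff_def)
next
  assume "odd r" "even s"
  then obtain i j where "r = Suc (2 * i)" "s = 2 * j" by (auto elim!: evenE oddE)
  thus ?thesis by (simp add: a_coeff_def)
next
  assume "odd r" "odd s"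
  then obtain i j where "r = Suc (2 * i)" "s = Suc (2 * j)" by (auto elim!: oddE)
  thus ?thesis by (simp add: a_coeff_def)
qed

text \<open>On the left, \<open>x\<close> forms an inversion with every element of \<open>B\<close>,
  which adds exactly \<open>card B\<close> inversions.\<close>

lemma shuffle_sign_insert_greatest_left:
  assumes "finite A" "finite B" "\<And>a. a \<in> A \<Longrightarrow> a < x" "\<And>b. b \<in> B \<Longrightarrow> b < x"
  shows "shuffle_sign (insert x A) B = (-1) ^ card B * shuffle_sign A B"
proof -
  have "{(a, b). a \<in> {x} \<and> b \<in> B \<and> b < a} = Pair x ` B"
    using assms(4) by auto
  hence "shuffle_sign {x} B = (-1) ^ card B"
    by (simp add: shuffle_sign_def card_image inj_on_def)
  moreover have "shuffle_sign ({x} \<union> A) B = shuffle_sign {x} B * shuffle_sign A B"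
    using assms by (intro shuffle_sign_Un_left) auto
  ultimately show ?thesis by simp
qed

text \<open>On the right, \<open>x\<close> is never the smaller entry of a pair, so no inversion is
  added.\<close>

lemma shuffle_sign_insert_greatest_right:
  assumes "\<And>a. a \<in> A \<Longrightarrow> a < x"
  shows "shuffle_sign A (insert x B) = shuffle_sign A B"
proof -
  have "{(a, b). a \<in> A \<and> b \<in> insert x B \<and> b < a} = {(a, b). a \<in> A \<and> b \<in> B \<and> b < a}"
    using assms by (auto dest: less_asym)
  thus ?thesis by (simp only: shuffle_sign_def)
qed

text \<open>The two pieces are told apart by membership of \<open>x\<close>; they give the two terms
  of the recursion.\<close>

lemma subsets_insert_card_Suc:
  assumes "finite D" "x \<notin> D"
  shows "{A. A \<subseteq> insert x D \<and> card A = Suc r}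
    = {A. A \<subseteq> D \<and> card A = Suc r} \<union> insert x ` {A. A \<subseteq> D \<and> card A = r}"
    (is "?L = ?R")
proof
  show "?L \<subseteq> ?R"
  proof
    fix A assume A: "A \<in> ?L"
    show "A \<in> ?R"
    proof (cases "x \<in> A")
      case True
      hence "A = insert x (A - {x})" "A - {x} \<subseteq> D" "card (A - {x}) = r"
        using A by auto
      thus ?thesis by blast
    qed (use A in auto)
  qed
  show "?R \<subseteq> ?L"
  proof
    fix A assume "A \<in> ?R"
    then consider "A \<subseteq> D" "card A = Suc r" | B where "A = insert x B" "B \<subseteq> D" "card B = r"
      by blast
    thus "A \<in> ?L"
    proof cases
      case 2
      hence "finite B" "x \<notin> B" using assms finite_subset by auto
      thus ?thesis using 2 by auto
    qed auto
  qed
qed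

lemma sum_shuffle_sign:
  assumes "finite C" "card C = r + s"
  shows "(\<Sum>A | A \<subseteq> C \<and> card A = r. shuffle_sign A (C - A)) = rat_of_nat (a_coeff r s)"
  using assms
\<comment> \<open>Each new element exceeds all earlier ones. Both \<open>r\<close> and
  \<open>s\<close> vary, because removing it lowers one or the other.\<close>
proof (induction C arbitrary: r s rule: finite_linorder_max_induct)
  case empty
  hence "r = 0" "s = 0" by auto
  moreover have "{A. A \<subseteq> ({}::nat set) \<and> card A = 0} = {{}}" by auto
  ultimately show ?case by (simp del: subset_empty)
next
  case (insert x D)
  have x: "x \<notin> D" using insert.hyps(2) by blast
  have fin: "finite A" if "A \<subseteq> D" for A using that insert.hyps(1) finite_subset by blast
  have card: "Suc (card D) = r + s" using insert x by simp
  \<comment> \<open>The recursion needs both sizes positive; otherwise a single splitting is left,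
    with one side empty and sign 1.\<close>
  consider "r = 0" | "s = 0" | r' s' where "r = Suc r'" "s = Suc s'"
    by (meson not0_implies_Suc)
  thus ?case
  proof cases
    case 1
    have "{A. A \<subseteq> insert x D \<and> card A = 0} = {{}}"
      using insert.hyps(1) by (auto dest: finite_subset)
    thus ?thesis using 1 by simp
  next
    case 2
    have "{A. A \<subseteq> insert x D \<and> card A = r} = {insert x D}"
    proof (intro equalityI subsetI)
      fix A assume "A \<in> {A. A \<subseteq> insert x D \<and> card A = r}"
      hence "A = insert x D"
        using insert.prems insert.hyps(1) 2 by (intro card_subset_eq) simp_all
      thus "A \<in> {insert x D}" by simp
    qed (use insert.prems 2 in simp)
    thus ?thesis using 2 by simp
  next
    case 3
    let ?S = "\<lambda>k. {A. A \<subseteq> D \<and> card A = k}"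
    have out: "shuffle_sign A (insert x D - A) = shuffle_sign A (D - A)" if "A \<in> ?S r" for A
    proof -
      have "insert x D - A = insert x (D - A)" using that x by auto
      thus ?thesis
        using that insert.hyps(2) by (auto intro!: shuffle_sign_insert_greatest_right)
    qed
    \<comment> \<open>Here \<open>x\<close> lies in the left part and is inverted with all
      \<open>s\<close> elements of the complement.\<close>
    have inn: "shuffle_sign (insert x A) (insert x D - insert x A)
        = (-1) ^ s * shuffle_sign A (D - A)" if "A \<in> ?S r'" for A
    proof -
      have "insert x D - insert x A = D - A" using that x by auto
      moreover have "card (D - A) = s"
        using that fin card 3 by (simp add: card_Diff_subset)
      moreover have "shuffle_sign (insert x A) (D - A)
          = (-1) ^ card (D - A) * shuffle_sign A (D - A)"
        using that fin insert.hyps by (intro shuffle_sign_insert_greatest_left) auto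
      ultimately show ?thesis by simp
    qed
    have inj: "inj_on (insert x) (?S r')"
      using x by (auto intro!: inj_onI dest: insert_ident[THEN iffD1, rotated 2])
    have "(\<Sum>A | A \<subseteq> insert x D \<and> card A = r. shuffle_sign A (insert x D - A))
        = (\<Sum>A\<in>?S r. shuffle_sign A (insert x D - A))
          + (\<Sum>A\<in>insert x ` ?S r'. shuffle_sign A (insert x D - A))"
      unfolding 3(1) subsets_insert_card_Suc[OF insert.hyps(1) x]
      using insert.hyps(1) x by (intro sum.union_disjoint) auto
    also have "\<dots> = (\<Sum>A\<in>?S r. shuffle_sign A (D - A))
          + (-1) ^ s * (\<Sum>A\<in>?S r'. shuffle_sign A (D - A))"
      using out inn by (simp add: sum.reindex[OF inj] sum_distrib_left)
    \<comment> \<open>Both induction hypotheses apply, since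
      \<open>card D = r + s' = r' + s\<close>.\<close>
    also have "\<dots> = rat_of_nat (a_coeff r s') + (-1) ^ s * rat_of_nat (a_coeff r' s)"
      using insert.IH[of r s'] insert.IH[of r' s] card 3 by simp
    also have "\<dots> = rat_of_nat (a_coeff r s)"
      unfolding 3 by (rule a_coeff_Suc_Suc[symmetric])
    finally show ?thesis .
  qed
qed

text \<open>Distinct monomials are distinct coordinate vectors, so at most one summand is nonzero at
  \<open>C\<close>.\<close>

lemma F_ones_apply: "F_ones n r C = (if C \<subseteq> {1..n} \<and> card C = r then 1 else 0)"
proof -
  let ?S = "{A. A \<subseteq> {1..n} \<and> card A = r}"
  have fin: "finite ?S" by simp
  have "F_ones n r C = (\<Sum>A\<in>?S. theta_set n A C)"
    unfolding F_ones_def using fin theta_set_closed by (intro exterior_finsum_apply) auto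
  also have "\<dots> = (\<Sum>A\<in>?S. if C = A then 1 else 0)"
  proof (intro sum.cong refl)
    fix A assume "A \<in> ?S"
    hence "finite A" using finite_subset by blast
    thus "theta_set n A C = (if C = A then 1 else 0)" by (simp add: theta_set_eq)
  qed
  also have "\<dots> = (if C \<in> ?S then 1 else 0)"
    using fin by (simp only: sum.delta')
  finally show ?thesis by simp
qed

theorem proposition2p3:
  fixes n r s :: nat
  assumes "n \<ge> 1"
  shows "F_ones n r \<otimes>\<^bsub>exterior_algebra n\<^esub> F_ones n s
    = rat_of_nat (a_coeff r s) \<odot>\<^bsub>exterior_algebra n\<^esub> F_ones n (r + s)"
proof
  fix C
  have "(F_ones n r \<otimes>\<^bsub>exterior_algebra n\<^esub> F_ones n s) C
      = (\<Sum>A\<in>Pow C. shuffle_sign A (C - A) * F_ones n r A * F_ones n s (C - A))"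
    by (simp add: exterior_algebra_def)
  also have "\<dots> = rat_of_nat (a_coeff r s) * F_ones n (r + s) C"
  proof (cases "C \<subseteq> {1..n} \<and> card C = r + s")
    case True
    hence fin: "finite C" using finite_subset by blast
    have "card (C - A) = s" if "A \<subseteq> C" "card A = r" for A
      using that True fin finite_subset[OF that(1)] by (simp add: card_Diff_subset)
    \<comment> \<open>Subsets of size other than \<open>r\<close> contribute nothing; for the others
      both coefficients are 1 and only the sign remains.\<close>
    hence "(\<Sum>A\<in>Pow C. shuffle_sign A (C - A) * F_ones n r A * F_ones n s (C - A))
        = (\<Sum>A | A \<subseteq> C \<and> card A = r. shuffle_sign A (C - A))"
      using fin True by (intro sum.mono_neutral_cong_right) (auto simp: F_ones_apply)
    thus ?thesis using True sum_shuffle_sign[OF fin] by (simp add: F_ones_apply)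
  next
    case False
    \<comment> \<open>A nonzero term would make \<open>C\<close> the disjoint union of an
      \<open>r\<close>-subset and an \<open>s\<close>-subset of \<open>{1..n}\<close>, against the
      case assumption.\<close>
    have "F_ones n r A * F_ones n s (C - A) = 0" if "A \<subseteq> C" for A
    proof (rule ccontr)
      assume "F_ones n r A * F_ones n s (C - A) \<noteq> 0"
      hence A: "A \<subseteq> {1..n}" "C - A \<subseteq> {1..n}" "card A = r" "card (C - A) = s"
        by (auto simp: F_ones_apply split: if_splits)
      hence "C \<subseteq> {1..n}" by blast
      moreover from this have "finite C" using finite_subset by blast
      hence "card C = r + s"
        using A that card_mono[OF _ that] finite_subset[OF that] by (simp add: card_Diff_subset)
      ultimately show False using False by blast
    qed
    hence "(\<Sum>A\<in>Pow C. shuffle_sign A (C - A) * F_ones n r A * F_ones n s (C - A)) = 0"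
      by (intro sum.neutral) (simp add: mult.assoc)
    moreover have "F_ones n (r + s) C = 0" using False by (simp only: F_ones_apply if_False)
    ultimately show ?thesis by simp
  qed
  also have "\<dots> = (rat_of_nat (a_coeff r s) \<odot>\<^bsub>exterior_algebra n\<^esub> F_ones n (r + s)) C"
    by (simp add: exterior_algebra_def)
  finally show "(F_ones n r \<otimes>\<^bsub>exterior_algebra n\<^esub> F_ones n s) C
      = (rat_of_nat (a_coeff r s) \<odot>\<^bsub>exterior_algebra n\<^esub> F_ones n (r + s)) C" .
qed

end
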